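(* Suppose that $m,n\ge 2$ and $m$ is even. Let $\mathcal{A}\in CD_{m,n}$. Then: (i) All the H-eigenvalues of $\mathcal{A}$ are nonnegative. (ii) $\mathcal{A}$ is SCD if and only if $\mathcal{A}$ is PD. In this case, all the H-eigenvalues of $\mathcal{A}$ are positive.
   Context: $S_{m,n}$ is the space of real symmetric tensors of order $m$ and dimension $n$. For $\mathbf{u}\in\mathbb{R}^n$, $\mathbf{u}^m\in S_{m,n}$ is the rank-one tensor with entries $u_{i_1}\cdots u_{i_m}$. A tensor $\mathcal{A}\in S_{m,n}$ is completely decomposable (in $CD_{m,n}$) if $\mathcal{A}=\sum_{j=1}^p\mathbf{u}_j^m$ for finitely many $\mathbf{u}_j\in\mathbb{R}^n$; it is strongly completely decomposable (SCD) if such a representation exists with $\mathbf{u}_1,\dots,\mathbf{u}_p$ spanning $\mathbb{R}^n$. $\mathcal{A}=(a_{i_1\cdots i_m})$ is positive definite (PD) if $\mathcal{A}\mathbf{x}^m:=\sum_{i_1,\dots,i_m=1}^n a_{i_1\cdots i_m}x_{i_1}\cdots x_{i_m}>0$ for all $\mathbf{x}\in\mathbb{R}^n\setminus\{\mathbf{0}\}$. A real number $\lambda$ is an H-eigenvalue of $\mathcal{A}$ if there is $\mathbf{x}\in\mathbb{R}^n$, $\mathbf{x}\ne\mathbf{0}$, with $\mathcal{A}\mathbf{x}^{m-1}=\lambda\mathbf{x}^{[m-1]}$, where $(\mathcal{A}\mathbf{x}^{m-1})_i=\sum_{i_2,\dots,i_m=1}^n a_{i i_2\cdots i_m}x_{i_2}\cdots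 x_{i_m}$ and $(\mathbf{x}^{[m-1]})_i=x_i^{m-1}$. *)

theory Defs
  imports "HOL-Analysis.Analysis" "HOL-Combinatorics.Permutations"
begin

text \<open>
  The dimension \<open>n\<close> is \<open>CARD('n)\<close>. The entry with indices \<open>i\<^sub>1, ..., i\<^sub>m\<close> of a tensor \<open>A\<close> is
  \<open>A [i\<^sub>1, ..., i\<^sub>m]\<close>. A tensor of order \<open>m\<close> vanishes on index lists of any other length, so that
  HOL equality is equality of tensors.
\<close>

type_synonym 'n tensor = "'n list \<Rightarrow> real"

definition index_lists :: "nat \<Rightarrow> 'n::finite list set" where
  "index_lists m = {is. length is = m}"

definition sym_tensors :: "nat \<Rightarrow> 'n::finite tensor set" where
  "sym_tensors m =
    {A. (\<forall>is. is \<notin> index_lists m \<longrightarrow> A is = 0) \<and>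
        (\<forall>is \<in> index_lists m. \<forall>\<sigma>. \<sigma> permutes {..<m} \<longrightarrow> A (permute_list \<sigma> is) = A is)}"

definition vec_monomial :: "real ^ 'n \<Rightarrow> 'n::finite list \<Rightarrow> real" where
  "vec_monomial x is = (\<Prod>i\<leftarrow>is. x $ i)"

definition rank_one :: "nat \<Rightarrow> real ^ 'n \<Rightarrow> 'n::finite tensor" where
  "rank_one m u = (\<lambda>is. if is \<in> index_lists m then vec_monomial u is else 0)"

definition completely_decomposable :: "nat \<Rightarrow> 'n::finite tensor set" where
  "completely_decomposable m =
    {A \<in> sym_tensors m. \<exists>p (u :: nat \<Rightarrow> real ^ 'n).
       A = (\<lambda>is. \<Sum>j<p. rank_one m (u j) is)}"

definition strongly_completely_decomposable :: "nat \<Rightarrow> 'n::finite tensor set" where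
  "strongly_completely_decomposable m =
    {A \<in> sym_tensors m. \<exists>p (u :: nat \<Rightarrow> real ^ 'n).
       A = (\<lambda>is. \<Sum>j<p. rank_one m (u j) is) \<and> span (u ` {..<p}) = UNIV}"

definition tensor_form :: "nat \<Rightarrow> 'n::finite tensor \<Rightarrow> real ^ 'n \<Rightarrow> real" where
  "tensor_form m A x = (\<Sum>is\<in>index_lists m. A is * vec_monomial x is)"

definition positive_definite :: "nat \<Rightarrow> 'n::finite tensor \<Rightarrow> bool" where
  "positive_definite m A \<longleftrightarrow> (\<forall>x. x \<noteq> 0 \<longrightarrow> tensor_form m A x > 0)"

text \<open>The vector \<open>A x\<^sup>m\<^sup>-\<^sup>1\<close>; here and below \<open>m \<ge> 1\<close> is intended.\<close>

definition tensor_contract :: "nat \<Rightarrow> 'n::finite tensor \<Rightarrow> real ^ 'n \<Rightarrow> real ^ 'n" where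
  "tensor_contract m A x = (\<chi> i. \<Sum>is\<in>index_lists (m - 1). A (i # is) * vec_monomial x is)"

definition H_eigenvalue :: "nat \<Rightarrow> 'n::finite tensor \<Rightarrow> real \<Rightarrow> bool" where
  "H_eigenvalue m A l \<longleftrightarrow>
    (\<exists>x. x \<noteq> 0 \<and> tensor_contract m A x = l *\<^sub>R (\<chi> i. (x $ i) ^ (m - 1)))"

lemma finite_index_lists: "finite (index_lists m :: 'n::finite list set)"
  using finite_lists_length_eq[of "UNIV :: 'n set" m] by (simp add: index_lists_def)

lemma rank_one_in_sym_tensors: "rank_one m u \<in> sym_tensors m"
proof -
  have "vec_monomial u (permute_list \<sigma> is) = vec_monomial u is"
    if "\<sigma> permutes {..<m}" "length is = m" for \<sigma> "is"
    using that mset_permute_list[of \<sigma> "is"]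
    by (simp add: vec_monomial_def flip: prod_mset_prod_list)
  then show ?thesis
    by (auto simp: sym_tensors_def rank_one_def index_lists_def)
qed

end

theory Submission
  imports Defs
begin

text \<open>
  Both parts come from evaluating the form of \<open>A = \<Sum>\<^sub>j u\<^sub>j\<^sup>m\<close> as a sum of powers of linear forms,
  \<open>A x\<^sup>m = \<Sum>\<^sub>j (u\<^sub>j \<bullet> x)\<^sup>m\<close> (lemma \<open>tensor_form_decomposition\<close>). For even \<open>m\<close> every summand is
  nonnegative, so \<open>A x\<^sup>m \<ge> 0\<close>, and \<open>A x\<^sup>m\<close> vanishes exactly when \<open>x\<close> is orthogonal to all the
  \<open>u\<^sub>j\<close>. A nonzero such \<open>x\<close> exists if and only if the \<open>u\<^sub>j\<close> fail to span the space. Hence \<open>A\<close> is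
  positive definite if and only if the vectors of any one decomposition span
  (lemma \<open>positive_definite_iff_span\<close>); in particular the spanning property does not depend on
  the decomposition.

  The eigenvalues are read off from the form: pairing \<open>A x\<^sup>m\<^sup>-\<^sup>1 = l x\<^bsup>[m-1]\<^esup>\<close> with \<open>x\<close> gives
  \<open>A x\<^sup>m = l \<Sum>\<^sub>i x\<^sub>i\<^sup>m\<close>, where the sum on the right is positive for \<open>x \<noteq> 0\<close>, so \<open>l\<close> has the sign
  of \<open>A x\<^sup>m\<close> (lemma \<open>H_eigenvalueE\<close>).
\<close>

lemma vec_monomial_Nil [simp]: "vec_monomial x [] = 1"
  by (simp add: vec_monomial_def)

lemma vec_monomial_Cons [simp]: "vec_monomial x (i # is) = x $ i * vec_monomial x is"
  by (simp add: vec_monomial_def)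

lemma sum_index_lists_Suc:
  fixes f :: "'n::finite list \<Rightarrow> real"
  shows "(\<Sum>is\<in>index_lists (Suc m). f is) = (\<Sum>i\<in>UNIV. \<Sum>is\<in>index_lists m. f (i # is))"
proof -
  have "bij_betw (\<lambda>(i, is). i # is) (UNIV \<times> index_lists m) (index_lists (Suc m) :: 'n list set)"
    by (auto simp: bij_betw_def inj_on_def index_lists_def length_Suc_conv image_iff)
  from sum.reindex_bij_betw[OF this, of f] show ?thesis
    by (simp add: sum.cartesian_product case_prod_unfold)
qed

text \<open>Expanding the power of the sum \<open>u \<bullet> x = \<Sum>\<^sub>i u\<^sub>i x\<^sub>i\<close> gives one term for each index list.\<close>

lemma sum_vec_monomial_mult:
  fixes u x :: "real ^ 'n::finite"
  shows "(\<Sum>is\<in>index_lists m. vec_monomial u is * vec_monomial x is) = (u \<bullet> x) ^ m"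
proof (induction m)
  case 0
  then show ?case by (simp add: index_lists_def)
next
  case (Suc m)
  have "(\<Sum>is\<in>index_lists (Suc m). vec_monomial u is * vec_monomial x is) =
      (\<Sum>i\<in>UNIV. \<Sum>is\<in>index_lists m. (u $ i * x $ i) * (vec_monomial u is * vec_monomial x is))"
    by (simp add: sum_index_lists_Suc mult_ac)
  also have "\<dots> = (u \<bullet> x) * (u \<bullet> x) ^ m"
    by (simp add: Suc.IH inner_vec_def flip: sum_distrib_left sum_distrib_right)
  finally show ?case by simp
qed

lemma tensor_form_decomposition:
  fixes u :: "'j \<Rightarrow> real ^ 'n::finite"
  shows "tensor_form m (\<lambda>is. \<Sum>j\<in>J. rank_one m (u j) is) x = (\<Sum>j\<in>J. (u j \<bullet> x) ^ m)"
proof -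
  have "tensor_form m (\<lambda>is. \<Sum>j\<in>J. rank_one m (u j) is) x =
      (\<Sum>is\<in>index_lists m. \<Sum>j\<in>J. vec_monomial (u j) is * vec_monomial x is)"
    by (simp add: tensor_form_def rank_one_def sum_distrib_right)
  also have "\<dots> = (\<Sum>j\<in>J. (u j \<bullet> x) ^ m)"
    by (subst sum.swap) (simp add: sum_vec_monomial_mult)
  finally show ?thesis .
qed

text \<open>
  A sum of even powers is zero only if every base is zero, so the form degenerates exactly on the
  orthogonal complement of the \<open>u j\<close>. The hypothesis \<open>m > 0\<close> excludes the constant form
  obtained from zeroth powers, which can be positive whatever the \<open>u j\<close> span.
\<close>

lemma positive_definite_iff_span:
  fixes u :: "'j \<Rightarrow> real ^ 'n::finite"
  assumes "finite J" "even m" "m > 0"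
  shows "positive_definite m (\<lambda>is. \<Sum>j\<in>J. rank_one m (u j) is) \<longleftrightarrow> span (u ` J) = UNIV"
    (is "positive_definite m ?A \<longleftrightarrow> _")
proof
  assume pd: "positive_definite m ?A"
  show "span (u ` J) = UNIV"
  proof (rule ccontr)
    assume "span (u ` J) \<noteq> UNIV"
    then obtain a where a: "a \<noteq> 0" "\<And>x. x \<in> span (u ` J) \<Longrightarrow> a \<bullet> x = 0"
      using span_not_UNIV_orthogonal by blast
    have "u j \<bullet> a = 0" if "j \<in> J" for j
      using a(2)[of "u j"] that by (simp add: span_base inner_commute)
    then have "tensor_form m ?A a = 0"
      using \<open>m > 0\<close> by (simp add: tensor_form_decomposition)
    with pd a(1) show False
      unfolding positive_definite_def by fastforce
  qed
next
  assume span: "span (u ` J) = UNIV"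
  show "positive_definite m ?A"
    unfolding positive_definite_def tensor_form_decomposition
  proof (intro allI impI)
    fix x :: "real ^ 'n"
    assume "x \<noteq> 0"
    have "\<exists>j\<in>J. u j \<bullet> x \<noteq> 0"
    proof (rule ccontr)
      assume "\<not> (\<exists>j\<in>J. u j \<bullet> x \<noteq> 0)"
      then have "orthogonal x y" if "y \<in> u ` J" for y
        using that by (auto simp: orthogonal_def inner_commute)
      \<comment> \<open>Then \<open>x\<close> is orthogonal to the whole span, hence to itself.\<close>
      then have "orthogonal x x"
        using orthogonal_to_span[of x "u ` J" x] span by auto
      with \<open>x \<noteq> 0\<close> show False
        by (simp add: orthogonal_def)
    qed
    then obtain k where "k \<in> J" "u k \<bullet> x \<noteq> 0" by blast
    then show "0 < (\<Sum>j\<in>J. (u j \<bullet> x) ^ m)"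
      using assms by (intro sum_pos2[of _ k]) (auto simp: zero_less_power_eq zero_le_even_power)
  qed
qed

lemma inner_tensor_contract:
  assumes "m > 0"
  shows "x \<bullet> tensor_contract m A x = tensor_form m A x"
proof -
  from assms obtain k where m: "m = Suc k"
    using gr0_implies_Suc by blast
  show ?thesis
    by (simp add: m inner_vec_def tensor_contract_def tensor_form_def sum_index_lists_Suc
        sum_distrib_left mult_ac)
qed

text \<open>
  Pairing the eigenvalue equation with the eigenvector turns it into a scalar equation; its
  factor \<open>c = \<Sum>\<^sub>i x\<^sub>i\<^sup>m\<close> is positive because \<open>m\<close> is even and \<open>x \<noteq> 0\<close>. Thus \<open>l\<close> inherits
  the sign of a value of the form.
\<close>

lemma H_eigenvalueE:
  fixes A :: "'n::finite tensor"
  assumes "H_eigenvalue m A l" "even m" "m > 0"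
  obtains x c where "x \<noteq> 0" "c > 0" "tensor_form m A x = l * c"
proof -
  from assms(1) obtain x where x: "x \<noteq> 0"
    "tensor_contract m A x = l *\<^sub>R (\<chi> i. (x $ i) ^ (m - 1))"
    by (auto simp: H_eigenvalue_def)
  have "tensor_form m A x = l * (\<Sum>i\<in>UNIV. x $ i * (x $ i) ^ (m - 1))"
    using inner_tensor_contract[OF \<open>m > 0\<close>, of x A] x(2)
    by (simp add: inner_vec_def sum_distrib_left mult.left_commute)
  also have "(\<Sum>i\<in>UNIV. x $ i * (x $ i) ^ (m - 1)) = (\<Sum>i\<in>UNIV. (x $ i) ^ m)"
    using \<open>m > 0\<close> by (simp flip: power_Suc)
  finally have form: "tensor_form m A x = l * (\<Sum>i\<in>UNIV. (x $ i) ^ m)" .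
  from x(1) obtain k where "x $ k \<noteq> 0"
    by (auto simp: vec_eq_iff)
  then have "0 < (\<Sum>i\<in>UNIV. (x $ i) ^ m)"
    using assms by (intro sum_pos2[of _ k]) (auto simp: zero_less_power_eq zero_le_even_power)
  with x(1) form that show thesis by blast
qed

theorem theorem5p1:
  fixes A :: "'n::finite tensor" and m :: nat
  assumes "m \<ge> 2" and "CARD('n) \<ge> 2" and "even m"
    and "A \<in> completely_decomposable m"
  shows "(\<forall>l. H_eigenvalue m A l \<longrightarrow> l \<ge> 0) \<and>
    (A \<in> strongly_completely_decomposable m \<longleftrightarrow> positive_definite m A) \<and>
    (A \<in> strongly_completely_decomposable m \<longrightarrow> (\<forall>l. H_eigenvalue m A l \<longrightarrow> l > 0))"
proof -
  have "m > 0" using assms(1) by simp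
  note m = \<open>even m\<close> \<open>m > 0\<close>
  from assms(4) obtain p and u :: "nat \<Rightarrow> real ^ 'n"
    where A: "A \<in> sym_tensors m" "A = (\<lambda>is. \<Sum>j<p. rank_one m (u j) is)"
    by (auto simp: completely_decomposable_def)
  have nonneg: "l \<ge> 0" if "H_eigenvalue m A l" for l
  proof -
    from that m obtain x c where "c > 0" "tensor_form m A x = l * c"
      by (rule H_eigenvalueE)
    moreover have "tensor_form m A x \<ge> 0"
      unfolding A(2) tensor_form_decomposition
      using m by (intro sum_nonneg) (simp add: zero_le_even_power)
    ultimately show ?thesis by (simp add: zero_le_mult_iff)
  qed
  have scd_iff: "A \<in> strongly_completely_decomposable m \<longleftrightarrow> positive_definite m A"
  proof
    assume "A \<in> strongly_completely_decomposable m"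
    \<comment> \<open>The spanning decomposition \<open>v\<close> may differ from \<open>u\<close>.\<close>
    then obtain q and v :: "nat \<Rightarrow> real ^ 'n"
      where "A = (\<lambda>is. \<Sum>j<q. rank_one m (v j) is)" "span (v ` {..<q}) = UNIV"
      by (auto simp: strongly_completely_decomposable_def)
    then show "positive_definite m A"
      using positive_definite_iff_span[of "{..<q}" m v] m by simp
  next
    assume "positive_definite m A"
    then have "span (u ` {..<p}) = UNIV"
      using positive_definite_iff_span[of "{..<p}" m u] m A(2) by simp
    with A show "A \<in> strongly_completely_decomposable m"
      unfolding strongly_completely_decomposable_def by blast
  qed
  have pos: "l > 0" if "positive_definite m A" "H_eigenvalue m A l" for l
  proof -
    from that(2) m obtain x c where "x \<noteq> 0" "c > 0" "tensor_form m A x = l * c"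
      by (rule H_eigenvalueE)
    with that(1) show ?thesis
      by (metis positive_definite_def zero_less_mult_pos2)
  qed
  show ?thesis
    using nonneg scd_iff pos by blast
qed

end
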